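(* Playfair ring theory (with intuitionistic logic) does not imply that reciprocals of positive elements exist; that is, the formula $P(x)\to\exists y\,(x\cdot y=1)$ is not provable in Playfair ring theory.
   Context: Playfair ring theory is the theory, with intuitionistic first-order logic, in the language of commutative rings ($0,1,+,\cdot,-$) with a unary predicate $P(x)$ ("$x$ is positive"), whose axioms are the commutative ring axioms together with: stability of equality: $\neg x\neq y\to x=y$; EF0: $0\neq 1$; EF2: $P(x)\wedge P(y)\to P(x+y)\wedge P(x\cdot y)$; EF3: $x+y=0\to\neg(P(x)\wedge P(y))$; EF4: $x+y=0\wedge\neg P(x)\wedge\neg P(y)\to x=0$; EF5: $x+y=0\wedge\neg P(y)\to\exists z\,(z\cdot z=x)$; EF6 (Markov's principle): $\neg\neg P(x)\to P(x)$; EF7: $(\forall y\,(x\cdot y\neq 1))\to x=0$; EF8 (bounded quotients exist): $|a|\le|b|\,y\to\exists z\,(a=bz)$. Here $x<y$ abbreviates $P(y-x)$, $x\le y$ abbreviates $\neg(y<x)$, $\sqrt{x}$ denotes the (non-negative) square root of $x\ge 0$, and $|x|=\sqrt{x^2}$. *)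

theory Defs
  imports Main
begin

text \<open>Syntax of first-order logic with equality over the language \<open>0, 1, +, \<cdot>, -, P\<close>.
  Variables are de Bruijn indices: \<open>Var 0\<close> is bound by the innermost enclosing quantifier,
  and an index that is not bound by a quantifier is a free variable.\<close>

datatype tm =
    Var nat
  | Zero                (\<open>\<^bold>0\<close>)
  | One                 (\<open>\<^bold>1\<close>)
  | Add tm tm           (infixl \<open>\<^bold>+\<close> 85)
  | Mul tm tm           (infixl \<open>\<^bold>\<cdot>\<close> 90)
  | Minus tm            (\<open>\<^bold>- _\<close> [96] 95)

datatype fm =
    Eq tm tm            (infix \<open>\<^bold>=\<close> 70)
  | Pos tm
  | Bot                 (\<open>\<^bold>\<bottom>\<close>)
  | And fm fm           (infixr \<open>\<^bold>\<and>\<close> 60)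
  | Or fm fm            (infixr \<open>\<^bold>\<or>\<close> 58)
  | Imp fm fm           (infixr \<open>\<^bold>\<longrightarrow>\<close> 56)
  | All fm              (\<open>\<^bold>\<forall> _\<close> [56] 56)
  | Ex fm               (\<open>\<^bold>\<exists> _\<close> [56] 56)

abbreviation Neg :: "fm \<Rightarrow> fm"  (\<open>\<^bold>\<not> _\<close> [65] 65)
  where "\<^bold>\<not> \<phi> \<equiv> \<phi> \<^bold>\<longrightarrow> \<^bold>\<bottom>"

abbreviation Neq :: "tm \<Rightarrow> tm \<Rightarrow> fm"  (infix \<open>\<^bold>\<noteq>\<close> 70)
  where "s \<^bold>\<noteq> t \<equiv> \<^bold>\<not> (s \<^bold>= t)"


section \<open>Substitution\<close>

primrec subst_tm :: "(nat \<Rightarrow> tm) \<Rightarrow> tm \<Rightarrow> tm" where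
  "subst_tm \<sigma> (Var n) = \<sigma> n"
| "subst_tm \<sigma> \<^bold>0 = \<^bold>0"
| "subst_tm \<sigma> \<^bold>1 = \<^bold>1"
| "subst_tm \<sigma> (s \<^bold>+ t) = subst_tm \<sigma> s \<^bold>+ subst_tm \<sigma> t"
| "subst_tm \<sigma> (s \<^bold>\<cdot> t) = subst_tm \<sigma> s \<^bold>\<cdot> subst_tm \<sigma> t"
| "subst_tm \<sigma> (\<^bold>- t) = \<^bold>- subst_tm \<sigma> t"

definition lift_tm :: "tm \<Rightarrow> tm" where
  "lift_tm = subst_tm (\<lambda>n. Var (Suc n))"

text \<open>The substitution to be used under one more quantifier.\<close>

definition up :: "(nat \<Rightarrow> tm) \<Rightarrow> nat \<Rightarrow> tm" where
  "up \<sigma> = case_nat (Var 0) (\<lambda>n. lift_tm (\<sigma> n))"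

primrec subst_fm :: "(nat \<Rightarrow> tm) \<Rightarrow> fm \<Rightarrow> fm" where
  "subst_fm \<sigma> (s \<^bold>= t) = (subst_tm \<sigma> s \<^bold>= subst_tm \<sigma> t)"
| "subst_fm \<sigma> (Pos t) = Pos (subst_tm \<sigma> t)"
| "subst_fm \<sigma> \<^bold>\<bottom> = \<^bold>\<bottom>"
| "subst_fm \<sigma> (\<phi> \<^bold>\<and> \<psi>) = (subst_fm \<sigma> \<phi> \<^bold>\<and> subst_fm \<sigma> \<psi>)"
| "subst_fm \<sigma> (\<phi> \<^bold>\<or> \<psi>) = (subst_fm \<sigma> \<phi> \<^bold>\<or> subst_fm \<sigma> \<psi>)"
| "subst_fm \<sigma> (\<phi> \<^bold>\<longrightarrow> \<psi>) = (subst_fm \<sigma> \<phi> \<^bold>\<longrightarrow> subst_fm \<sigma> \<psi>)"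
| "subst_fm \<sigma> (\<^bold>\<forall> \<phi>) = (\<^bold>\<forall> (subst_fm (up \<sigma>) \<phi>))"
| "subst_fm \<sigma> (\<^bold>\<exists> \<phi>) = (\<^bold>\<exists> (subst_fm (up \<sigma>) \<phi>))"

definition lift_fm :: "fm \<Rightarrow> fm" where
  "lift_fm = subst_fm (\<lambda>n. Var (Suc n))"

text \<open>\<open>inst t \<phi>\<close> replaces \<open>Var 0\<close> by \<open>t\<close> in the body \<open>\<phi>\<close> of a quantified formula
  and lowers the other free variables by one.\<close>

definition inst :: "tm \<Rightarrow> fm \<Rightarrow> fm" where
  "inst t = subst_fm (case_nat t Var)"


section \<open>Intuitionistic natural deduction with equality\<close>

text \<open>In \<open>AllI\<close> and \<open>ExE\<close> the eigenvariable is \<open>Var 0\<close>; lifting the context (and the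
  conclusion of \<open>ExE\<close>) makes it fresh there.\<close>

inductive derives :: "fm set \<Rightarrow> fm \<Rightarrow> bool"  (infix \<open>\<turnstile>\<close> 50) where
  Assm: "\<phi> \<in> \<Gamma> \<Longrightarrow> \<Gamma> \<turnstile> \<phi>"
| BotE: "\<Gamma> \<turnstile> \<^bold>\<bottom> \<Longrightarrow> \<Gamma> \<turnstile> \<phi>"
| AndI: "\<Gamma> \<turnstile> \<phi> \<Longrightarrow> \<Gamma> \<turnstile> \<psi> \<Longrightarrow> \<Gamma> \<turnstile> \<phi> \<^bold>\<and> \<psi>"
| AndE1: "\<Gamma> \<turnstile> \<phi> \<^bold>\<and> \<psi> \<Longrightarrow> \<Gamma> \<turnstile> \<phi>"
| AndE2: "\<Gamma> \<turnstile> \<phi> \<^bold>\<and> \<psi> \<Longrightarrow> \<Gamma> \<turnstile> \<psi>"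
| OrI1: "\<Gamma> \<turnstile> \<phi> \<Longrightarrow> \<Gamma> \<turnstile> \<phi> \<^bold>\<or> \<psi>"
| OrI2: "\<Gamma> \<turnstile> \<psi> \<Longrightarrow> \<Gamma> \<turnstile> \<phi> \<^bold>\<or> \<psi>"
| OrE: "\<Gamma> \<turnstile> \<phi> \<^bold>\<or> \<psi> \<Longrightarrow> insert \<phi> \<Gamma> \<turnstile> \<chi> \<Longrightarrow> insert \<psi> \<Gamma> \<turnstile> \<chi> \<Longrightarrow> \<Gamma> \<turnstile> \<chi>"
| ImpI: "insert \<phi> \<Gamma> \<turnstile> \<psi> \<Longrightarrow> \<Gamma> \<turnstile> \<phi> \<^bold>\<longrightarrow> \<psi>"
| ImpE: "\<Gamma> \<turnstile> \<phi> \<^bold>\<longrightarrow> \<psi> \<Longrightarrow> \<Gamma> \<turnstile> \<phi> \<Longrightarrow> \<Gamma> \<turnstile> \<psi>"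
| AllI: "lift_fm ` \<Gamma> \<turnstile> \<phi> \<Longrightarrow> \<Gamma> \<turnstile> \<^bold>\<forall> \<phi>"
| AllE: "\<Gamma> \<turnstile> \<^bold>\<forall> \<phi> \<Longrightarrow> \<Gamma> \<turnstile> inst t \<phi>"
| ExI: "\<Gamma> \<turnstile> inst t \<phi> \<Longrightarrow> \<Gamma> \<turnstile> \<^bold>\<exists> \<phi>"
| ExE: "\<Gamma> \<turnstile> \<^bold>\<exists> \<phi> \<Longrightarrow> insert \<phi> (lift_fm ` \<Gamma>) \<turnstile> lift_fm \<psi> \<Longrightarrow> \<Gamma> \<turnstile> \<psi>"
| EqRefl: "\<Gamma> \<turnstile> t \<^bold>= t"
| EqSubst: "\<Gamma> \<turnstile> s \<^bold>= t \<Longrightarrow> \<Gamma> \<turnstile> inst s \<phi> \<Longrightarrow> \<Gamma> \<turnstile> inst t \<phi>"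


section \<open>Playfair ring theory\<close>

definition Less :: "tm \<Rightarrow> tm \<Rightarrow> fm"  (infix \<open>\<^bold><\<close> 70)
  where "s \<^bold>< t = Pos (t \<^bold>+ \<^bold>- s)"

definition Le :: "tm \<Rightarrow> tm \<Rightarrow> fm"  (infix \<open>\<^bold>\<le>\<close> 70)
  where "s \<^bold>\<le> t = (\<^bold>\<not> (t \<^bold>< s))"

definition is_sqrt :: "tm \<Rightarrow> tm \<Rightarrow> fm"
  where "is_sqrt u x = (\<^bold>0 \<^bold>\<le> u \<^bold>\<and> u \<^bold>\<cdot> u \<^bold>= x)"

definition is_abs :: "tm \<Rightarrow> tm \<Rightarrow> fm"
  where "is_abs u x = is_sqrt u (x \<^bold>\<cdot> x)"

text \<open>The language has no symbol for square roots, so \<open>\<bar>a\<bar> \<le> \<bar>b\<bar> y\<close> is a formula containing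
  definite descriptions. They are eliminated in the usual way:
  there are \<open>u = \<bar>a\<bar>\<close> and \<open>v = \<bar>b\<bar>\<close> with \<open>u \<le> v y\<close>.\<close>

definition abs_le_abs_mul :: "tm \<Rightarrow> tm \<Rightarrow> tm \<Rightarrow> fm" where
  "abs_le_abs_mul a b y =
    (\<^bold>\<exists> \<^bold>\<exists> (is_abs (Var 1) (lift_tm (lift_tm a)) \<^bold>\<and> is_abs (Var 0) (lift_tm (lift_tm b)) \<^bold>\<and>
       Var 1 \<^bold>\<le> Var 0 \<^bold>\<cdot> lift_tm (lift_tm y)))"

text \<open>All axioms are universally closed. With the prefix \<open>\<^bold>\<forall> \<^bold>\<forall>\<close> the variables \<open>x, y\<close> are
  \<open>Var 1, Var 0\<close>, and with \<open>\<^bold>\<forall> \<^bold>\<forall> \<^bold>\<forall>\<close> the variables \<open>x, y, z\<close> (in \<open>EF8\<close>: \<open>a, b, y\<close>) are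
  \<open>Var 2, Var 1, Var 0\<close>; a further quantifier raises these indices by one.\<close>

definition ring_axioms :: "fm set" where
  "ring_axioms = {
     \<^bold>\<forall> \<^bold>\<forall> \<^bold>\<forall> ((Var 2 \<^bold>+ Var 1) \<^bold>+ Var 0 \<^bold>= Var 2 \<^bold>+ (Var 1 \<^bold>+ Var 0)),
     \<^bold>\<forall> \<^bold>\<forall> (Var 1 \<^bold>+ Var 0 \<^bold>= Var 0 \<^bold>+ Var 1),
     \<^bold>\<forall> (Var 0 \<^bold>+ \<^bold>0 \<^bold>= Var 0),
     \<^bold>\<forall> (Var 0 \<^bold>+ \<^bold>- Var 0 \<^bold>= \<^bold>0),
     \<^bold>\<forall> \<^bold>\<forall> \<^bold>\<forall> ((Var 2 \<^bold>\<cdot> Var 1) \<^bold>\<cdot> Var 0 \<^bold>= Var 2 \<^bold>\<cdot> (Var 1 \<^bold>\<cdot> Var 0)),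
     \<^bold>\<forall> \<^bold>\<forall> (Var 1 \<^bold>\<cdot> Var 0 \<^bold>= Var 0 \<^bold>\<cdot> Var 1),
     \<^bold>\<forall> (Var 0 \<^bold>\<cdot> \<^bold>1 \<^bold>= Var 0),
     \<^bold>\<forall> \<^bold>\<forall> \<^bold>\<forall> (Var 2 \<^bold>\<cdot> (Var 1 \<^bold>+ Var 0) \<^bold>= Var 2 \<^bold>\<cdot> Var 1 \<^bold>+ Var 2 \<^bold>\<cdot> Var 0)}"

definition Eq_stability :: fm where
  "Eq_stability = (\<^bold>\<forall> \<^bold>\<forall> (\<^bold>\<not> (Var 1 \<^bold>\<noteq> Var 0) \<^bold>\<longrightarrow> Var 1 \<^bold>= Var 0))"

definition EF0 :: fm where
  "EF0 = (\<^bold>0 \<^bold>\<noteq> \<^bold>1)"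

definition EF2 :: fm where
  "EF2 = (\<^bold>\<forall> \<^bold>\<forall> (Pos (Var 1) \<^bold>\<and> Pos (Var 0) \<^bold>\<longrightarrow> Pos (Var 1 \<^bold>+ Var 0) \<^bold>\<and> Pos (Var 1 \<^bold>\<cdot> Var 0)))"

definition EF3 :: fm where
  "EF3 = (\<^bold>\<forall> \<^bold>\<forall> (Var 1 \<^bold>+ Var 0 \<^bold>= \<^bold>0 \<^bold>\<longrightarrow> \<^bold>\<not> (Pos (Var 1) \<^bold>\<and> Pos (Var 0))))"

definition EF4 :: fm where
  "EF4 = (\<^bold>\<forall> \<^bold>\<forall> (Var 1 \<^bold>+ Var 0 \<^bold>= \<^bold>0 \<^bold>\<and> \<^bold>\<not> Pos (Var 1) \<^bold>\<and> \<^bold>\<not> Pos (Var 0) \<^bold>\<longrightarrow> Var 1 \<^bold>= \<^bold>0))"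

definition EF5 :: fm where
  "EF5 = (\<^bold>\<forall> \<^bold>\<forall> (Var 1 \<^bold>+ Var 0 \<^bold>= \<^bold>0 \<^bold>\<and> \<^bold>\<not> Pos (Var 0) \<^bold>\<longrightarrow> \<^bold>\<exists> (Var 0 \<^bold>\<cdot> Var 0 \<^bold>= Var 2)))"

definition EF6 :: fm where
  "EF6 = (\<^bold>\<forall> (\<^bold>\<not> \<^bold>\<not> Pos (Var 0) \<^bold>\<longrightarrow> Pos (Var 0)))"

definition EF7 :: fm where
  "EF7 = (\<^bold>\<forall> ((\<^bold>\<forall> (Var 1 \<^bold>\<cdot> Var 0 \<^bold>\<noteq> \<^bold>1)) \<^bold>\<longrightarrow> Var 0 \<^bold>= \<^bold>0))"

definition EF8 :: fm where
  "EF8 = (\<^bold>\<forall> \<^bold>\<forall> \<^bold>\<forall> (abs_le_abs_mul (Var 2) (Var 1) (Var 0) \<^bold>\<longrightarrow> \<^bold>\<exists> (Var 3 \<^bold>= Var 2 \<^bold>\<cdot> Var 0)))"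

definition playfair_ring_theory :: "fm set" where
  "playfair_ring_theory =
     ring_axioms \<union> {Eq_stability, EF0, EF2, EF3, EF4, EF5, EF6, EF7, EF8}"

end

theory Submission
  imports Defs Complex_Main
begin

text \<open>
  By soundness of Kripke semantics it is enough to find a model in which every axiom is
  forced and some positive element has no reciprocal. The ring of bounded real sequences,
  compared coordinate by coordinate, provides one. Apart from the ring operations, only \<open>EF5\<close>
  and \<open>EF8\<close> require elements to exist, and there boundedness of the given elements is
  inherited: a root of a bounded sequence is bounded, and a quotient as in \<open>EF8\<close> can be
  bounded by \<open>y\<close>. Nothing, however, bounds the reciprocal of a positive
  sequence: \<open>1 / (n + 1)\<close> is bounded and positive in every coordinate, but its
  reciprocal \<open>n + 1\<close> is unbounded (\<open>no_bounded_inverse_Suc\<close>).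

  At the root of the Kripke model equality and positivity hold if they hold in all
  coordinates. Above the root there is a world for each coordinate \<open>n\<close>, where only the
  \<open>n\<close>-th entries count and the ring becomes the field of real numbers. Hence a negated
  formula is forced at the root exactly if the formula fails in each of these fields
  (\<open>forces_Neg\<close>). This gives \<open>EF4\<close>, although the root has zero divisors and its order is not
  total, and it gives \<open>EF7\<close>: the hypothesis says that \<open>x\<close> has no reciprocal in any
  of the fields, thus that \<open>x\<close> vanishes in every coordinate, which is much stronger than not
  being invertible in the ring of bounded sequences.

  It is convenient to admit all sets \<open>S\<close> of coordinates as worlds, with \<open>T\<close> above \<open>S\<close>
  if \<open>T \<subseteq> S\<close>. The real numbers at a single coordinate are the entries of bounded (constant)
  sequences, so that the same domain serves at all worlds and only the meaning of equality
  varies. The empty set is a world at which every formula is forced, falsity included;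
  it lies above all others, and admitting it removes the side conditions \<open>T \<noteq> {}\<close>.
\<close>

section \<open>Bounded real sequences\<close>

lemma Bseq_plus:
  fixes f g :: "nat \<Rightarrow> real"
  assumes "Bseq f" "Bseq g"
  shows "Bseq (\<lambda>n. f n + g n)"
proof -
  obtain K L where "\<And>n. norm (f n) \<le> K" "\<And>n. norm (g n) \<le> L"
    using assms by (metis BseqE)
  then have "norm (f n + g n) \<le> K + L" for n
    by (meson add_mono norm_triangle_le)
  then show ?thesis by (rule BseqI')
qed

lemma Bseq_sqrt:
  assumes "Bseq f"
  shows "Bseq (\<lambda>n. sqrt (f n))"
proof -
  obtain K where "\<And>n. norm (f n) \<le> K"
    using assms by (metis BseqE)
  then have "norm (sqrt (f n)) \<le> sqrt K" for n
    by (simp flip: real_sqrt_abs')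
  then show ?thesis by (rule BseqI')
qed


section \<open>Forcing over sets of coordinates\<close>

primrec val :: "(nat \<Rightarrow> nat \<Rightarrow> real) \<Rightarrow> tm \<Rightarrow> nat \<Rightarrow> real" where
  "val e (Var i) n = e i n"
| "val e \<^bold>0 n = 0"
| "val e \<^bold>1 n = 1"
| "val e (s \<^bold>+ t) n = val e s n + val e t n"
| "val e (s \<^bold>\<cdot> t) n = val e s n * val e t n"
| "val e (\<^bold>- t) n = - val e t n"

text \<open>The clause for \<open>\<^bold>\<forall>\<close> does not mention the worlds above \<open>S\<close>: the domain is the same
  there, and forcing is monotone.\<close>

primrec forces :: "nat set \<Rightarrow> (nat \<Rightarrow> nat \<Rightarrow> real) \<Rightarrow> fm \<Rightarrow> bool" where
  "forces S e (s \<^bold>= t) \<longleftrightarrow> (\<forall>n\<in>S. val e s n = val e t n)"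
| "forces S e (Pos t) \<longleftrightarrow> (\<forall>n\<in>S. 0 < val e t n)"
| "forces S e \<^bold>\<bottom> \<longleftrightarrow> S = {}"
| "forces S e (\<phi> \<^bold>\<and> \<psi>) \<longleftrightarrow> forces S e \<phi> \<and> forces S e \<psi>"
| "forces S e (\<phi> \<^bold>\<or> \<psi>) \<longleftrightarrow> forces S e \<phi> \<or> forces S e \<psi>"
| "forces S e (\<phi> \<^bold>\<longrightarrow> \<psi>) \<longleftrightarrow> (\<forall>T\<subseteq>S. forces T e \<phi> \<longrightarrow> forces T e \<psi>)"
| "forces S e (\<^bold>\<forall> \<phi>) \<longleftrightarrow> (\<forall>f. Bseq f \<longrightarrow> forces S (case_nat f e) \<phi>)"
| "forces S e (\<^bold>\<exists> \<phi>) \<longleftrightarrow> (\<exists>f. Bseq f \<and> forces S (case_nat f e) \<phi>)"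

lemma forces_mono: "forces S e \<phi> \<Longrightarrow> T \<subseteq> S \<Longrightarrow> forces T e \<phi>"
proof (induction \<phi> arbitrary: S T e)
  case (Imp \<phi> \<psi>)
  then show ?case by (meson forces.simps(6) subset_trans)
next
  case (And \<phi> \<psi>)
  then show ?case by (metis forces.simps(4))
next
  case (Or \<phi> \<psi>)
  then show ?case by (metis forces.simps(5))
next
  case (All \<phi>)
  then show ?case by (metis forces.simps(7))
next
  case (Ex \<phi>)
  then show ?case by (metis forces.simps(8))
qed auto

lemma forces_empty: "forces {} e \<phi>"
proof (induction \<phi> arbitrary: e)
  case (Ex \<phi>)
  have "Bseq (\<lambda>n. 0 :: real)" by (rule BseqI'[where K = 0]) simp
  with Ex show ?case unfolding forces.simps by blast
qed auto

text \<open>A nonempty world has a singleton above it, so by monotonicity a negation need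
  only be tested on singletons, that is, in the fields of real numbers.\<close>

lemma forces_Neg: "forces S e (\<^bold>\<not> \<phi>) \<longleftrightarrow> (\<forall>n\<in>S. \<not> forces {n} e \<phi>)"
proof
  assume neg: "forces S e (\<^bold>\<not> \<phi>)"
  show "\<forall>n\<in>S. \<not> forces {n} e \<phi>"
  proof (intro ballI notI)
    fix n assume "n \<in> S" "forces {n} e \<phi>"
    with neg have "{n} = {}" by (metis forces.simps(3,6) empty_subsetI insert_subset)
    then show False by simp
  qed
next
  assume none: "\<forall>n\<in>S. \<not> forces {n} e \<phi>"
  have "T = {}" if "T \<subseteq> S" "forces T e \<phi>" for T
  proof (rule ccontr)
    assume "T \<noteq> {}"
    then obtain n where "n \<in> T" by blast
    then have "forces {n} e \<phi>" using that(2) forces_mono[of T e \<phi> "{n}"] by simp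
    then show False using none \<open>n \<in> T\<close> that(1) by blast
  qed
  then show "forces S e (\<^bold>\<not> \<phi>)" by simp
qed

text \<open>The general clause for implications also matches negations and would hide their
  description by singletons, so for simplification it is restricted to other implications.\<close>

lemma forces_Imp:
  "\<psi> \<noteq> \<^bold>\<bottom> \<Longrightarrow> forces S e (\<phi> \<^bold>\<longrightarrow> \<psi>) \<longleftrightarrow> (\<forall>T\<subseteq>S. forces T e \<phi> \<longrightarrow> forces T e \<psi>)"
  by simp

declare forces.simps(6) [simp del] forces_Imp [simp] forces_Neg [simp]

text \<open>A double negation reports what happens at the points of a world. Atoms are determined
  by these points; this is why equality is stable and Markov's principle holds.\<close>

lemma forces_stable:
  assumes pointwise: "\<And>T. (\<And>n. n \<in> T \<Longrightarrow> forces {n} e \<phi>) \<Longrightarrow> forces T e \<phi>"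
  shows "forces S e (\<^bold>\<not> \<^bold>\<not> \<phi> \<^bold>\<longrightarrow> \<phi>)"
proof -
  have "forces T e \<phi>" if "forces T e (\<^bold>\<not> \<^bold>\<not> \<phi>)" for T
  proof (rule pointwise)
    fix n assume "n \<in> T"
    then show "forces {n} e \<phi>" using that unfolding forces_Neg by simp
  qed
  then show ?thesis unfolding forces.simps(6)[of S e "\<^bold>\<not> \<^bold>\<not> \<phi>"] by blast
qed

lemma forces_Less: "forces S e (s \<^bold>< t) \<longleftrightarrow> (\<forall>n\<in>S. val e s n < val e t n)"
  by (simp add: Less_def)

lemma forces_Le: "forces S e (s \<^bold>\<le> t) \<longleftrightarrow> (\<forall>n\<in>S. val e s n \<le> val e t n)"
  unfolding Le_def forces_Neg by (auto simp: forces_Less not_less)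


section \<open>Soundness\<close>

lemma val_subst_tm: "val e (subst_tm \<sigma> t) = val (\<lambda>i. val e (\<sigma> i)) t"
proof
  show "val e (subst_tm \<sigma> t) n = val (\<lambda>i. val e (\<sigma> i)) t n" for n
    by (induction t) simp_all
qed

lemma val_Var: "val e (Var i) = e i"
  by (rule ext) simp

lemma val_lift_tm: "val (case_nat f e) (lift_tm t) = val e t"
  unfolding lift_tm_def val_subst_tm val_Var by simp

lemma forces_subst_fm: "forces S e (subst_fm \<sigma> \<phi>) = forces S (\<lambda>i. val e (\<sigma> i)) \<phi>"
proof (induction \<phi> arbitrary: S e \<sigma>)
  case (All \<phi>)
  have "(\<lambda>i. val (case_nat f e) (up \<sigma> i)) = case_nat f (\<lambda>i. val e (\<sigma> i))" for f
    by (rule ext) (simp add: up_def val_lift_tm val_Var split: nat.split)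
  with All show ?case by simp
next
  case (Ex \<phi>)
  have "(\<lambda>i. val (case_nat f e) (up \<sigma> i)) = case_nat f (\<lambda>i. val e (\<sigma> i))" for f
    by (rule ext) (simp add: up_def val_lift_tm val_Var split: nat.split)
  with Ex show ?case by simp
qed (simp_all add: val_subst_tm forces.simps(6))

lemma forces_lift_fm: "forces S (case_nat f e) (lift_fm \<phi>) = forces S e \<phi>"
  unfolding lift_fm_def forces_subst_fm val_Var by simp

lemma forces_inst: "forces S e (inst t \<phi>) = forces S (case_nat (val e t) e) \<phi>"
proof -
  have "(\<lambda>i. val e (case_nat t Var i)) = case_nat (val e t) e"
    by (rule ext) (simp add: val_Var split: nat.split)
  then show ?thesis unfolding inst_def forces_subst_fm by simp
qed

lemma val_cong:
  assumes "\<And>i. e i n = e' i n"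
  shows "val e t n = val e' t n"
  using assms by (induction t) simp_all

text \<open>At the world \<open>S\<close> sequences that agree on \<open>S\<close> are the same element; this is what
  the substitution rule for equality needs.\<close>

lemma forces_cong:
  assumes "\<And>i n. n \<in> S \<Longrightarrow> e i n = e' i n"
  shows "forces S e \<phi> = forces S e' \<phi>"
  using assms
proof (induction \<phi> arbitrary: S e e')
  case (Eq s t)
  then have "val e s n = val e' s n \<and> val e t n = val e' t n" if "n \<in> S" for n
    using that val_cong by blast
  then show ?case by simp
next
  case (Pos t)
  then have "val e t n = val e' t n" if "n \<in> S" for n
    using that val_cong by blast
  then show ?case by simp
next
  case (Imp \<phi> \<psi>)
  have "forces T e \<phi> = forces T e' \<phi>" "forces T e \<psi> = forces T e' \<psi>" if "T \<subseteq> S" for T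
    using that by (auto intro!: Imp.IH Imp.prems)
  then show ?case by (auto simp: forces.simps(6))
next
  case (And \<phi> \<psi>)
  have "forces S e \<phi> = forces S e' \<phi>" "forces S e \<psi> = forces S e' \<psi>"
    by (auto intro!: And.IH And.prems)
  then show ?case by simp
next
  case (Or \<phi> \<psi>)
  have "forces S e \<phi> = forces S e' \<phi>" "forces S e \<psi> = forces S e' \<psi>"
    by (auto intro!: Or.IH Or.prems)
  then show ?case by simp
next
  case (All \<phi>)
  have "forces S (case_nat f e) \<phi> = forces S (case_nat f e') \<phi>" for f
    by (rule All.IH) (simp add: All.prems split: nat.split)
  then show ?case by simp
next
  case (Ex \<phi>)
  have "forces S (case_nat f e) \<phi> = forces S (case_nat f e') \<phi>" for f
    by (rule Ex.IH) (simp add: Ex.prems split: nat.split)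
  then show ?case by simp
qed simp

lemma Bseq_val:
  assumes "\<And>i. Bseq (e i)"
  shows "Bseq (val e t)"
proof (induction t)
  case (Var i)
  show ?case unfolding val_Var by (rule assms)
next
  case Zero
  show ?case by (rule BseqI'[where K = 0]) simp
next
  case One
  show ?case by (rule BseqI'[where K = 1]) simp
next
  case (Add s t)
  then have "Bseq (\<lambda>n. val e s n + val e t n)" by (rule Bseq_plus)
  then show ?case by (simp add: Bseq_def)
next
  case (Mul s t)
  then have "Bseq (\<lambda>n. val e s n * val e t n)" by (rule Bseq_mult)
  then show ?case by (simp add: Bseq_def)
next
  case (Minus t)
  then show ?case by (simp add: Bseq_def)
qed

lemma Bseq_case_nat: "Bseq f \<Longrightarrow> (\<And>i. Bseq (e i)) \<Longrightarrow> Bseq (case_nat f e i)"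
  by (simp split: nat.split)

text \<open>The assumption on \<open>e\<close> is needed for \<open>AllE\<close> and \<open>ExI\<close>: with it every term denotes a
  bounded sequence, hence an element over which the quantifiers range. Discharging an
  assumption moves to a smaller world \<open>T\<close>, which is why \<open>S\<close> must vary in the induction.\<close>

lemma soundness:
  assumes "\<Gamma> \<turnstile> \<phi>"
    and "\<And>i. Bseq (e i)"
    and "\<And>\<gamma>. \<gamma> \<in> \<Gamma> \<Longrightarrow> forces S e \<gamma>"
  shows "forces S e \<phi>"
  using assms
proof (induction arbitrary: S e rule: derives.induct)
  case (BotE \<Gamma> \<phi>)
  have "forces S e \<^bold>\<bottom>" using BotE.prems by (rule BotE.IH)
  then show ?case by (simp add: forces_empty)
next
  case (AndI \<Gamma> \<phi> \<psi>)
  have "forces S e \<phi>" using AndI.prems by (rule AndI.IH(1))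
  moreover have "forces S e \<psi>" using AndI.prems by (rule AndI.IH(2))
  ultimately show ?case by simp
next
  case (AndE1 \<Gamma> \<phi> \<psi>)
  have "forces S e (\<phi> \<^bold>\<and> \<psi>)" using AndE1.prems by (rule AndE1.IH)
  then show ?case by simp
next
  case (AndE2 \<Gamma> \<phi> \<psi>)
  have "forces S e (\<phi> \<^bold>\<and> \<psi>)" using AndE2.prems by (rule AndE2.IH)
  then show ?case by simp
next
  case (OrI1 \<Gamma> \<phi> \<psi>)
  have "forces S e \<phi>" using OrI1.prems by (rule OrI1.IH)
  then show ?case by simp
next
  case (OrI2 \<Gamma> \<psi> \<phi>)
  have "forces S e \<psi>" using OrI2.prems by (rule OrI2.IH)
  then show ?case by simp
next
  case (OrE \<Gamma> \<phi> \<psi> \<chi>)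
  have "forces S e (\<phi> \<^bold>\<or> \<psi>)" using OrE.prems by (rule OrE.IH(1))
  then consider "forces S e \<phi>" | "forces S e \<psi>" by auto
  then show ?case
  proof cases
    case 1
    then show ?thesis using OrE.prems by (intro OrE.IH(2)) auto
  next
    case 2
    then show ?thesis using OrE.prems by (intro OrE.IH(3)) auto
  qed
next
  case (ImpI \<phi> \<Gamma> \<psi>)
  have "forces T e \<psi>" if "T \<subseteq> S" "forces T e \<phi>" for T
  proof (rule ImpI.IH)
    show "forces T e \<gamma>" if "\<gamma> \<in> insert \<phi> \<Gamma>" for \<gamma>
      using that \<open>T \<subseteq> S\<close> \<open>forces T e \<phi>\<close> ImpI.prems(2) forces_mono by blast
  qed (rule ImpI.prems(1))
  then show ?case by (simp add: forces.simps(6))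
next
  case (ImpE \<Gamma> \<phi> \<psi>)
  have "forces S e (\<phi> \<^bold>\<longrightarrow> \<psi>)" using ImpE.prems by (rule ImpE.IH(1))
  moreover have "forces S e \<phi>" using ImpE.prems by (rule ImpE.IH(2))
  ultimately show ?case by (simp add: forces.simps(6))
next
  case (AllI \<Gamma> \<phi>)
  have "forces S (case_nat f e) \<phi>" if "Bseq f" for f
  proof (rule AllI.IH)
    show "Bseq (case_nat f e i)" for i
      using that AllI.prems(1) by (rule Bseq_case_nat)
    show "forces S (case_nat f e) \<gamma>" if "\<gamma> \<in> lift_fm ` \<Gamma>" for \<gamma>
      using that AllI.prems(2) by (auto simp: forces_lift_fm)
  qed
  then show ?case by simp
next
  case (AllE \<Gamma> \<phi> t)
  have "forces S e (\<^bold>\<forall> \<phi>)" using AllE.prems by (rule AllE.IH)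
  moreover have "Bseq (val e t)" using AllE.prems(1) by (rule Bseq_val)
  ultimately show ?case by (simp add: forces_inst)
next
  case (ExI \<Gamma> t \<phi>)
  have "forces S e (inst t \<phi>)" using ExI.prems by (rule ExI.IH)
  moreover have "Bseq (val e t)" using ExI.prems(1) by (rule Bseq_val)
  ultimately show ?case by (auto simp: forces_inst)
next
  case (ExE \<Gamma> \<phi> \<psi>)
  have "forces S e (\<^bold>\<exists> \<phi>)" using ExE.prems by (rule ExE.IH(1))
  then obtain f where "Bseq f" and f: "forces S (case_nat f e) \<phi>" by auto
  have "forces S (case_nat f e) (lift_fm \<psi>)"
  proof (rule ExE.IH(2))
    show "Bseq (case_nat f e i)" for i
      using \<open>Bseq f\<close> ExE.prems(1) by (rule Bseq_case_nat)
    show "forces S (case_nat f e) \<gamma>" if "\<gamma> \<in> insert \<phi> (lift_fm ` \<Gamma>)" for \<gamma>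
      using that f ExE.prems(2) by (auto simp: forces_lift_fm)
  qed
  then show ?case by (simp add: forces_lift_fm)
next
  case (EqSubst \<Gamma> s t \<phi>)
  have "forces S e (s \<^bold>= t)" using EqSubst.prems by (rule EqSubst.IH(1))
  then have "forces S (case_nat (val e s) e) \<phi> = forces S (case_nat (val e t) e) \<phi>"
    by (intro forces_cong) (simp split: nat.split)
  moreover have "forces S e (inst s \<phi>)" using EqSubst.prems by (rule EqSubst.IH(2))
  ultimately show ?case by (simp add: forces_inst)
qed simp_all


section \<open>The axioms hold in the ring of bounded sequences\<close>

lemma forces_is_abs: "forces S e (is_abs u x) \<longleftrightarrow> (\<forall>n\<in>S. val e u n = \<bar>val e x n\<bar>)"
proof -
  have "0 \<le> u \<and> u * u = x * x \<longleftrightarrow> u = \<bar>x\<bar>" for u x :: real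
    by (auto simp: abs_if square_eq_iff)
  then show ?thesis
    by (auto simp: is_abs_def is_sqrt_def forces_Le)
qed

lemma forces_abs_le_abs_mul:
  assumes "forces S e (abs_le_abs_mul a b y)" "n \<in> S"
  shows "\<bar>val e a n\<bar> \<le> \<bar>val e b n\<bar> * val e y n"
  using assms by (auto simp: abs_le_abs_mul_def forces_is_abs forces_Le val_lift_tm)

text \<open>This is where \<open>EF8\<close> uses the factor \<open>y\<close>: it is the only bound on the quotient.
  Outside the world \<open>S\<close> the hypothesis says nothing, so there the quotient is replaced
  by \<open>0\<close> to keep it bounded; on \<open>S\<close> it is at most \<open>\<bar>y\<bar>\<close> also where \<open>b\<close> vanishes, since
  \<open>x / 0 = 0\<close> and \<open>a\<close> vanishes there too.\<close>

lemma bounded_quotient: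
  fixes a b y :: "nat \<Rightarrow> real"
  assumes "Bseq y" and le: "\<And>n. n \<in> S \<Longrightarrow> \<bar>a n\<bar> \<le> \<bar>b n\<bar> * y n"
  shows "\<exists>z. Bseq z \<and> (\<forall>n\<in>S. a n = b n * z n)"
proof -
  define z where "z = (\<lambda>n. if n \<in> S then a n / b n else 0)"
  obtain K where K: "\<And>n. norm (y n) \<le> K" using \<open>Bseq y\<close> by (metis BseqE)
  have "norm (z n) \<le> K" for n
  proof (cases "n \<in> S \<and> b n \<noteq> 0")
    case True
    then have "\<bar>a n\<bar> / \<bar>b n\<bar> \<le> y n"
      using le[of n] by (simp add: divide_le_eq mult.commute)
    also have "y n \<le> K" using K[of n] by simp
    finally show ?thesis using True by (simp add: z_def)
  next
    case False
    have "0 \<le> K" using K[of n] by (meson norm_ge_zero order_trans)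
    with False show ?thesis by (auto simp: z_def)
  qed
  then have "Bseq z" by (rule BseqI')
  moreover have "a n = b n * z n" if "n \<in> S" for n
    using le[OF that] that by (cases "b n = 0") (auto simp: z_def)
  ultimately show ?thesis by blast
qed

lemma forces_ring_axioms: "\<phi> \<in> ring_axioms \<Longrightarrow> forces S e \<phi>"
  by (auto simp: ring_axioms_def algebra_simps numeral_2_eq_2)

lemma forces_Eq_stability: "forces S e Eq_stability"
  unfolding Eq_stability_def forces.simps(7) by (intro allI impI forces_stable) simp

lemma forces_EF0: "forces S e EF0"
  unfolding EF0_def forces_Neg by simp

lemma forces_EF2: "forces S e EF2"
  by (auto simp: EF2_def add_pos_pos)

lemma forces_EF3: "forces S e EF3"
  by (force simp: EF3_def)

lemma forces_EF4: "forces S e EF4"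
  by (fastforce simp: EF4_def not_less)

lemma forces_EF5: "forces S e EF5"
proof -
  have "\<exists>z. Bseq z \<and> (\<forall>n\<in>T. z n * z n = x n)"
    if "Bseq x" and "\<forall>n\<in>T. x n + y n = 0" and "\<forall>n\<in>T. \<not> 0 < y n"
    for T and x y :: "nat \<Rightarrow> real"
  proof (intro exI conjI ballI)
    show "Bseq (\<lambda>n. sqrt (x n))" using \<open>Bseq x\<close> by (rule Bseq_sqrt)
    show "sqrt (x n) * sqrt (x n) = x n" if "n \<in> T" for n
      using \<open>n \<in> T\<close> \<open>\<forall>n\<in>T. x n + y n = 0\<close> \<open>\<forall>n\<in>T. \<not> 0 < y n\<close> by force
  qed
  then show ?thesis by (simp add: EF5_def numeral_2_eq_2) blast
qed

lemma forces_EF6: "forces S e EF6"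
  unfolding EF6_def forces.simps(7) by (intro allI impI forces_stable) simp

lemma forces_EF7: "forces S e EF7"
proof -
  have "x n = 0"
    if "n \<in> T" and no_inverse: "\<And>f m. Bseq f \<Longrightarrow> m \<in> T \<Longrightarrow> x m * f m \<noteq> 1"
    for T n and x :: "nat \<Rightarrow> real"
  proof (rule ccontr)
    assume "x n \<noteq> 0"
    \<comment> \<open>The reciprocal in the field at \<open>n\<close>, as an element of the common domain.\<close>
    have "Bseq (\<lambda>_. 1 / x n)" by (rule BseqI'[where K = "norm (1 / x n)"]) (rule order_refl)
    from no_inverse[OF this \<open>n \<in> T\<close>] \<open>x n \<noteq> 0\<close> show False by simp
  qed
  then show ?thesis by (auto simp: EF7_def)
qed

lemma forces_EF8: "forces S e EF8"
proof -
  have "\<exists>z. Bseq z \<and> (\<forall>n\<in>T. a n = b n * z n)"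
    if "Bseq y" "forces T (case_nat y (case_nat b (case_nat a e)))
          (abs_le_abs_mul (Var 2) (Var 1) (Var 0))" for T a b y
    using that forces_abs_le_abs_mul[OF that(2)]
    by (intro bounded_quotient[of y]) (auto simp: numeral_2_eq_2)
  then show ?thesis by (simp add: EF8_def eval_nat_numeral)
qed

lemma forces_playfair_ring_theory: "\<phi> \<in> playfair_ring_theory \<Longrightarrow> forces S e \<phi>"
  by (auto simp: playfair_ring_theory_def forces_ring_axioms forces_Eq_stability forces_EF0
      forces_EF2 forces_EF3 forces_EF4 forces_EF5 forces_EF6 forces_EF7 forces_EF8
      simp del: forces_Imp forces_Neg)


section \<open>A positive element without a reciprocal\<close>

lemma no_bounded_inverse_Suc:
  assumes "Bseq f"
  shows "\<exists>n. inverse (real (Suc n)) * f n \<noteq> 1"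
proof (rule ccontr)
  assume "\<nexists>n. inverse (real (Suc n)) * f n \<noteq> 1"
  then have f: "f n = real (Suc n)" for n
    by (metis inverse_unique inverse_inverse_eq)
  obtain K where "\<And>n. norm (f n) \<le> K" using assms by (metis BseqE)
  then have "real (Suc n) \<le> K" for n by (metis f norm_of_nat)
  moreover obtain n where "K < real n" using reals_Archimedean2 by blast
  ultimately show False by (meson lessI less_trans not_less of_nat_less_iff)
qed

theorem theorem10p4:
  shows "\<not> (playfair_ring_theory \<turnstile> Pos (Var 0) \<^bold>\<longrightarrow> \<^bold>\<exists> (Var 1 \<^bold>\<cdot> Var 0 \<^bold>= \<^bold>1))"
proof
  assume derivation: "playfair_ring_theory \<turnstile> Pos (Var 0) \<^bold>\<longrightarrow> \<^bold>\<exists> (Var 1 \<^bold>\<cdot> Var 0 \<^bold>= \<^bold>1)"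
  define x :: "nat \<Rightarrow> real" where "x n = inverse (real (Suc n))" for n
  have "Bseq x"
    by (rule BseqI'[where K = 1]) (simp add: x_def inverse_le_1_iff)
  then have "forces UNIV (\<lambda>_. x) (Pos (Var 0) \<^bold>\<longrightarrow> \<^bold>\<exists> (Var 1 \<^bold>\<cdot> Var 0 \<^bold>= \<^bold>1))"
    by (intro soundness[OF derivation] forces_playfair_ring_theory)
  moreover have "forces UNIV (\<lambda>_. x) (Pos (Var 0))"
    by (simp add: x_def)
  ultimately have "forces UNIV (\<lambda>_. x) (\<^bold>\<exists> (Var 1 \<^bold>\<cdot> Var 0 \<^bold>= \<^bold>1))"
    by (metis forces.simps(6) subset_refl)
  then obtain f where "Bseq f" "\<forall>n. x n * f n = 1"
    by auto
  then show False
    using no_bounded_inverse_Suc unfolding x_def by blast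
qed

end
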